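(* Let $J,R:\mathbb{R}^n\to\mathbb{R}^{n\times n}$ with $J(x)=-J(x)^\top$ and $R(x)=R(x)^\top\ge 0$ for all $x\in\mathbb{R}^n$, let $Q=Q^\top\in\mathbb{R}^{n\times n}$ be positive definite, $B\in\mathbb{R}^{n\times 1}$, $H(x)=\tfrac12 x^\top Qx$, and $J_\pm(x)=I\pm\tfrac12(J(x)-R(x))Q$ (the matrix $J_-(x)$ is invertible for every $x$). Let $\mathbb{X}\subset\mathbb{R}^n$, $\mathbb{U}\subset\mathbb{R}$, $N\ge 1$, $x_0,x_N\in\mathbb{X}$, and consider the discrete-time optimal control problem $$\min_{(u_k)_{k=0}^{N-1}}\ \sum_{k=0}^{N-1} l(x_k,u_k),\qquad l(x_k,u_k)=u_kY_k,\qquad Y_k=B^\top QJ_-^{-1}(x_k)J_+(x_k)x_k+\tfrac12 B^\top QBu_k,$$ subject to $x_{k+1}=J_-^{-1}(x_k)J_+(x_k)x_k+Bu_k$ for $k=0,\dots,N-1$, with prescribed initial state $x_0$ and prescribed terminal state $x_N$, $u_k\in\mathbb{U}$ for $k=0,\dots,N-1$ and $x_k\in\mathbb{X}$ for $k=1,\dots,N$. Set $F(x)=R(x)^{1/2}QJ_-^{-1}(x)x$ and $\mathcal{M}=\{x\in\mathbb{R}^n : F(x)=0\}$. Assume: 1. $F$ is of class $C^2$. 2. $\mathcal{M}$ is nonempty and there exist an open neighborhood $G\subseteq\mathbb{R}^n$ of $\mathcal{M}$ and an integer $0<s<n$ such that $\dim\ker DF_x=s$ for all $x\in G$. 3. $V\subseteq\mathbb{R}^n$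 is an open set with $\mathcal{M}\subseteq V\subseteq\operatorname{int}(\operatorname{unpp}(\mathcal{M}))$ for which there is a constant $c>0$ with $c\,\operatorname{dist}(x,\mathcal{M})\le\|F(x)\|$ for all $x\in V$, and every optimal trajectory $(x_k^* )_{k=0}^N$ of the optimal control problem remains in $V$ for all times. Then the optimal control problem is strictly dissipative with respect to the manifold $\mathcal{M}$ with storage function $H$; that is, there exists $\alpha\in\mathcal{K}_\infty$ such that for every optimal control sequence $(u_k^* )_{k=0}^{N-1}$ with associated optimal state $(x_k^* )_{k=0}^N$ and every $k\in\{0,\dots,N-1\}$, $$H(x_{k+1}^* )-H(x_k^* )\le l(x_k^*,u_k^* )-\alpha(\operatorname{dist}(x_k^*,\mathcal{M})).$$
   Context: $R(x)^{1/2}$ denotes a (Cholesky) factor of $R(x)$, i.e. $(R(x)^{1/2})^\top R(x)^{1/2}=R(x)$, fixed for each $x$. $DF_x$ is the differential of $F$ at $x$, and $\operatorname{int}$ denotes the interior. For $\mathcal{M}\subseteq\mathbb{R}^n$, $\operatorname{dist}(x,\mathcal{M})$ is the Euclidean distance and $\operatorname{unpp}(\mathcal{M})=\{x\in\mathbb{R}^n : \text{there is a unique } \xi\in\mathcal{M} \text{ with } \operatorname{dist}(x,\mathcal{M})=\|x-\xi\|\}$. A continuous function $\alpha:\mathbb{R}_{\ge0}\to\mathbb{R}_{\ge0}$ is of class $\mathcal{K}_\infty$ if $\alpha(0)=0$ and $\alpha$ is strictly increasing and unbounded. An optimal control sequence is an admissible one (satisfying all constraints of the problem) that attains the minimum;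 the associated optimal state is the resulting state trajectory. *)

theory Defs
  imports "HOL-Analysis.Analysis"
begin

text \<open>Control sequences are functions on \<open>nat\<close>; for horizon \<open>N\<close> only their values at
  \<open>0, \<dots>, N - 1\<close> matter, since the states at times \<open>0, \<dots>, N\<close> depend on no others.\<close>

primrec trajectory :: "('x \<Rightarrow> 'u \<Rightarrow> 'x) \<Rightarrow> 'x \<Rightarrow> (nat \<Rightarrow> 'u) \<Rightarrow> nat \<Rightarrow> 'x" where
  "trajectory f x0 u 0 = x0"
| "trajectory f x0 u (Suc k) = f (trajectory f x0 u k) (u k)"

definition admissible_control ::
    "('x \<Rightarrow> 'u \<Rightarrow> 'x) \<Rightarrow> 'x set \<Rightarrow> 'u set \<Rightarrow> nat \<Rightarrow> 'x \<Rightarrow> 'x \<Rightarrow> (nat \<Rightarrow> 'u) \<Rightarrow> bool" where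
  "admissible_control f X U N x0 xN u \<longleftrightarrow>
     (\<forall>k<N. u k \<in> U) \<and>
     (\<forall>k\<in>{1..N}. trajectory f x0 u k \<in> X) \<and>
     trajectory f x0 u N = xN"

definition total_cost ::
    "('x \<Rightarrow> 'u \<Rightarrow> 'x) \<Rightarrow> ('x \<Rightarrow> 'u \<Rightarrow> real) \<Rightarrow> nat \<Rightarrow> 'x \<Rightarrow> (nat \<Rightarrow> 'u) \<Rightarrow> real" where
  "total_cost f l N x0 u = (\<Sum>k<N. l (trajectory f x0 u k) (u k))"

definition optimal_control ::
    "('x \<Rightarrow> 'u \<Rightarrow> 'x) \<Rightarrow> ('x \<Rightarrow> 'u \<Rightarrow> real) \<Rightarrow> 'x set \<Rightarrow> 'u set \<Rightarrow> nat \<Rightarrow> 'x \<Rightarrow> 'x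
       \<Rightarrow> (nat \<Rightarrow> 'u) \<Rightarrow> bool" where
  "optimal_control f l X U N x0 xN u \<longleftrightarrow>
     admissible_control f X U N x0 xN u \<and>
     (\<forall>v. admissible_control f X U N x0 xN v \<longrightarrow>
        total_cost f l N x0 u \<le> total_cost f l N x0 v)"

definition class_K_infinity :: "(real \<Rightarrow> real) set" where
  "class_K_infinity =
     {\<alpha>. continuous_on {0..} \<alpha> \<and> \<alpha> ` {0..} \<subseteq> {0..} \<and> \<alpha> 0 = 0 \<and>
          strict_mono_on {0..} \<alpha> \<and> \<not> bounded (\<alpha> ` {0..})}"

definition strictly_dissipative_wrt ::
    "('x::metric_space \<Rightarrow> 'u \<Rightarrow> 'x) \<Rightarrow> ('x \<Rightarrow> 'u \<Rightarrow> real) \<Rightarrow> 'x set \<Rightarrow> 'u set \<Rightarrow> nat \<Rightarrow> 'x \<Rightarrow> 'x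
       \<Rightarrow> 'x set \<Rightarrow> ('x \<Rightarrow> real) \<Rightarrow> bool" where
  "strictly_dissipative_wrt f l X U N x0 xN M S \<longleftrightarrow>
     (\<exists>\<alpha>\<in>class_K_infinity. \<forall>u. optimal_control f l X U N x0 xN u \<longrightarrow>
        (\<forall>k<N. S (trajectory f x0 u (Suc k)) - S (trajectory f x0 u k)
                 \<le> l (trajectory f x0 u k) (u k)
                    - \<alpha> (infdist (trajectory f x0 u k) M)))"

definition C2_map :: "('a::real_normed_vector \<Rightarrow> 'b::real_normed_vector) \<Rightarrow> bool" where
  "C2_map f \<longleftrightarrow>
     (\<exists>(f' :: 'a \<Rightarrow> 'a \<Rightarrow>\<^sub>L 'b) (f'' :: 'a \<Rightarrow> 'a \<Rightarrow>\<^sub>L 'a \<Rightarrow>\<^sub>L 'b).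
        (\<forall>x. (f has_derivative blinfun_apply (f' x)) (at x)) \<and>
        (\<forall>x. (f' has_derivative blinfun_apply (f'' x)) (at x)) \<and>
        continuous_on UNIV f'')"

definition unpp :: "'a::real_normed_vector set \<Rightarrow> 'a set" where
  "unpp M = {x. \<exists>!\<xi>. \<xi> \<in> M \<and> infdist x M = norm (x - \<xi>)}"

definition positive_semidefinite :: "real^'n^'n \<Rightarrow> bool" where
  "positive_semidefinite A \<longleftrightarrow> (\<forall>v. v \<bullet> (A *v v) \<ge> 0)"

definition positive_definite :: "real^'n^'n \<Rightarrow> bool" where
  "positive_definite A \<longleftrightarrow> (\<forall>v. v \<noteq> 0 \<longrightarrow> v \<bullet> (A *v v) > 0)"

definition hamiltonian :: "real^'n^'n \<Rightarrow> real^'n \<Rightarrow> real" where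
  "hamiltonian Q x = (1/2) * (x \<bullet> (Q *v x))"

definition J_plus ::
    "(real^'n \<Rightarrow> real^'n^'n) \<Rightarrow> (real^'n \<Rightarrow> real^'n^'n) \<Rightarrow> real^'n^'n \<Rightarrow> real^'n \<Rightarrow> real^'n^'n" where
  "J_plus J R Q x = mat 1 + (1/2) *\<^sub>R ((J x - R x) ** Q)"

definition J_minus ::
    "(real^'n \<Rightarrow> real^'n^'n) \<Rightarrow> (real^'n \<Rightarrow> real^'n^'n) \<Rightarrow> real^'n^'n \<Rightarrow> real^'n \<Rightarrow> real^'n^'n" where
  "J_minus J R Q x = mat 1 - (1/2) *\<^sub>R ((J x - R x) ** Q)"

text \<open>\<^const>\<open>matrix_inv\<close> is a genuine inverse wherever it is applied to \<^const>\<open>J_minus\<close> below.\<close>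

lemma invertible_J_minus:
  fixes J R :: "real^'n \<Rightarrow> real^'n^'n" and Q :: "real^'n^'n"
  assumes J: "transpose (J x) = - J x"
    and R: "positive_semidefinite (R x)"
    and Q: "transpose Q = Q" "positive_definite Q"
  shows "invertible (J_minus J R Q x)"
proof -
  have "z = 0" if z: "J_minus J R Q x *v z = 0" for z
  proof (rule ccontr)
    assume "z \<noteq> 0"
    define w where "w = Q *v z"
    have "z - (1/2) *\<^sub>R ((J x - R x) *v w) = 0"
      using z by (simp add: J_minus_def w_def matrix_vector_mult_diff_rdistrib
          scaleR_matrix_vector_assoc[symmetric] matrix_vector_mul_assoc)
    then have "z = (1/2) *\<^sub>R (J x *v w - R x *v w)"
      by (simp add: matrix_vector_mult_diff_rdistrib)
    then have "w \<bullet> z = w \<bullet> ((1/2) *\<^sub>R (J x *v w - R x *v w))"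
      by (rule arg_cong)
    then have "w \<bullet> z = (1/2) * (w \<bullet> (J x *v w) - w \<bullet> (R x *v w))"
      by (simp only: inner_scaleR_right inner_diff_right)
    moreover have "w \<bullet> (J x *v w) = 0"
    proof -
      have "w \<bullet> (J x *v w) = (transpose (J x) *v w) \<bullet> w"
        by (simp add: dot_lmul_matrix)
      also have "\<dots> = - (w \<bullet> (J x *v w))"
        using matrix_vector_mult_diff_rdistrib[of 0 "J x" w]
        by (simp add: J inner_commute)
      finally show ?thesis by simp
    qed
    moreover have "w \<bullet> (R x *v w) \<ge> 0"
      using R by (simp add: positive_semidefinite_def)
    moreover have "w \<bullet> z > 0"
      using Q(2) \<open>z \<noteq> 0\<close> by (simp add: positive_definite_def w_def inner_commute)
    ultimately show False by simp
  qed
  then show ?thesis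
    by (simp add: invertible_left_inverse matrix_left_invertible_ker)
qed

definition ph_step ::
    "(real^'n \<Rightarrow> real^'n^'n) \<Rightarrow> (real^'n \<Rightarrow> real^'n^'n) \<Rightarrow> real^'n^'n \<Rightarrow> real^'n
       \<Rightarrow> real^'n \<Rightarrow> real \<Rightarrow> real^'n" where
  "ph_step J R Q B x u = matrix_inv (J_minus J R Q x) *v (J_plus J R Q x *v x) + u *\<^sub>R B"

definition ph_output ::
    "(real^'n \<Rightarrow> real^'n^'n) \<Rightarrow> (real^'n \<Rightarrow> real^'n^'n) \<Rightarrow> real^'n^'n \<Rightarrow> real^'n
       \<Rightarrow> real^'n \<Rightarrow> real \<Rightarrow> real" where
  "ph_output J R Q B x u =
     B \<bullet> (Q *v (matrix_inv (J_minus J R Q x) *v (J_plus J R Q x *v x)))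
     + (1/2) * (B \<bullet> (Q *v B)) * u"

definition supplied_energy ::
    "(real^'n \<Rightarrow> real^'n^'n) \<Rightarrow> (real^'n \<Rightarrow> real^'n^'n) \<Rightarrow> real^'n^'n \<Rightarrow> real^'n
       \<Rightarrow> real^'n \<Rightarrow> real \<Rightarrow> real" where
  "supplied_energy J R Q B x u = u * ph_output J R Q B x u"

text \<open>\<open>Rh\<close> is a choice of factors of \<open>R\<close>, i.e. \<open>transpose (Rh x) ** Rh x = R x\<close>.\<close>

definition dissipation_map ::
    "(real^'n \<Rightarrow> real^'n^'n) \<Rightarrow> (real^'n \<Rightarrow> real^'n^'n) \<Rightarrow> (real^'n \<Rightarrow> real^'n^'n)
       \<Rightarrow> real^'n^'n \<Rightarrow> real^'n \<Rightarrow> real^'n" where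
  "dissipation_map J R Rh Q x = Rh x *v (Q *v (matrix_inv (J_minus J R Q x) *v x))"

end

theory Submission imports Defs begin

text \<open>The uncontrolled step is the implicit midpoint rule: with \<open>y = J\<^sub>-\<inverse> x\<close> it maps
  \<open>x = J\<^sub>- y\<close> to \<open>J\<^sub>+ y\<close>, whose midpoint is \<open>y\<close>. Since \<open>H\<close> is quadratic, the energy changes by
  exactly \<open>(Q y) \<bullet> (J - R) (Q y) = - \<parallel>F x\<parallel>\<^sup>2\<close>, and the impulse \<open>u B\<close> adds exactly
  the supplied energy. So the energy balance is an equality along every trajectory, and the lower bound
  on \<open>\<parallel>F\<parallel>\<close> turns it into strict dissipativity with \<open>\<alpha> r = c\<^sup>2 r\<^sup>2\<close>.\<close>

text \<open>Symmetry of \<open>Q\<close> merges the two mixed terms into one. This expansion serves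
  both the half steps around the midpoint and the control impulse.\<close>

lemma hamiltonian_add:
  assumes "transpose Q = Q"
  shows "hamiltonian Q (x + y) = hamiltonian Q x + y \<bullet> (Q *v x) + hamiltonian Q y"
proof -
  have "x \<bullet> (Q *v y) = y \<bullet> (Q *v x)"
    using assms by (metis dot_lmul_matrix inner_commute transpose_matrix_vector)
  then show ?thesis
    by (simp add: hamiltonian_def matrix_vector_right_distrib inner_add_left inner_add_right
        algebra_simps)
qed

lemma hamiltonian_scaleR: "hamiltonian Q (r *\<^sub>R x) = r\<^sup>2 * hamiltonian Q x"
  by (simp add: hamiltonian_def matrix_vector_mult_scaleR power2_eq_square)

text \<open>Moving \<open>A\<close> across the inner product replaces it by \<open>- A\<close>, so
  the value equals its own negative. Hence the interconnection \<open>J\<close> exchanges energy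
  without changing the total.\<close>

lemma skew_quadratic_form_eq_0:
  fixes A :: "real^'n^'n"
  assumes "transpose A = - A"
  shows "w \<bullet> (A *v w) = 0"
proof -
  have "w \<bullet> (A *v w) = (transpose A *v w) \<bullet> w"
    by (simp add: dot_lmul_matrix)
  also have "\<dots> = - (w \<bullet> (A *v w))"
    using matrix_vector_mult_diff_rdistrib[of 0 A w] by (simp add: assms inner_commute)
  finally show ?thesis by simp
qed

lemma J_plus_mult_vec:
  "J_plus J R Q x *v v = v + (1/2) *\<^sub>R ((J x - R x) *v (Q *v v))"
  by (simp add: J_plus_def matrix_vector_mult_add_rdistrib scaleR_matrix_vector_assoc[symmetric]
      matrix_vector_mul_assoc)

lemma J_minus_mult_vec:
  "J_minus J R Q x *v v = v - (1/2) *\<^sub>R ((J x - R x) *v (Q *v v))"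
  by (simp add: J_minus_def matrix_vector_mult_diff_rdistrib scaleR_matrix_vector_assoc[symmetric]
      matrix_vector_mul_assoc)

lemma ph_energy_balance:
  fixes J R Rh :: "real^'n \<Rightarrow> real^'n^'n"
  assumes J: "transpose (J x) = - J x"
    and R: "transpose (Rh x) ** Rh x = R x"
    and Q: "transpose Q = Q" "positive_definite Q"
  shows "hamiltonian Q (ph_step J R Q B x u) - hamiltonian Q x
    = supplied_energy J R Q B x u - (norm (dissipation_map J R Rh Q x))\<^sup>2"
proof -
  define P where "P = J_plus J R Q x"
  define K where "K = J_minus J R Q x"
  define y where "y = matrix_inv K *v x"
  define w where "w = Q *v y"
  define d where "d = (J x - R x) *v w"
  \<comment> \<open>With \<open>w = Q *v y\<close>, the vector \<open>Rh x *v w\<close> is exactly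
    \<open>dissipation_map J R Rh Q x\<close>.\<close>
  have w_R_w: "w \<bullet> (R x *v w) = (norm (Rh x *v w))\<^sup>2"
    by (metis R dot_lmul_matrix matrix_vector_mul_assoc power2_norm_eq_inner transpose_matrix_vector
        transpose_transpose)
  then have "positive_semidefinite (R x)"
    unfolding positive_semidefinite_def
    by (metis R dot_lmul_matrix matrix_vector_mul_assoc inner_ge_zero transpose_matrix_vector
        transpose_transpose)
  then have inv: "invertible K"
    unfolding K_def using J Q by (intro invertible_J_minus)
  \<comment> \<open>\<open>matrix_inv\<close> is a Hilbert choice; invertibility makes the chosen
    matrix a two-sided inverse.\<close>
  have right_inv: "K ** matrix_inv K = mat 1" and left_inv: "matrix_inv K ** K = mat 1"
    using someI_ex[OF inv[unfolded invertible_def]] by (simp_all add: matrix_inv_def)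
  have "K *v y = x"
    by (simp add: y_def matrix_vector_mul_assoc right_inv)
  then have x_eq: "x = y - (1/2) *\<^sub>R d"
    by (simp add: K_def J_minus_mult_vec d_def w_def)
  have P_y: "P *v y = y + (1/2) *\<^sub>R d"
    by (simp add: P_def J_plus_mult_vec d_def w_def)
  \<comment> \<open>\<open>P\<close> and \<open>K\<close> commute because both are affine in the
    same matrix \<open>(J x - R x) ** Q\<close>. This moves \<open>P\<close> past the inverse of
    \<open>K\<close>.\<close>
  have "K *v (P *v y) = P *v (K *v y)"
    by (simp add: P_def K_def J_plus_mult_vec J_minus_mult_vec matrix_vector_right_distrib
        matrix_vector_mult_diff_distrib matrix_vector_mult_scaleR scaleR_right_distrib
        scaleR_right_diff_distrib)
  then have "matrix_inv K *v (P *v x) = P *v y"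
    using \<open>K *v y = x\<close> left_inv by (metis matrix_vector_mul_assoc matrix_vector_mul_lid)
  then have a: "matrix_inv K *v (P *v x) = y + (1/2) *\<^sub>R d"
    by (simp add: P_y)
  \<comment> \<open>The endpoints are y + d/2 and y - d/2: the terms even in \<open>d\<close> cancel
    and the two halves of the mixed term add up.\<close>
  have "hamiltonian Q (y + (1/2) *\<^sub>R d) - hamiltonian Q x = d \<bullet> w"
    using hamiltonian_add[OF Q(1), of y "(1/2) *\<^sub>R d"]
      hamiltonian_add[OF Q(1), of y "(-1/2) *\<^sub>R d"] hamiltonian_scaleR[of Q "-1/2" d]
    by (simp add: x_eq hamiltonian_scaleR w_def power2_eq_square)
  also have "\<dots> = - (norm (Rh x *v w))\<^sup>2"
    using skew_quadratic_form_eq_0[OF J, of w] w_R_w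
    by (simp add: d_def matrix_vector_mult_diff_rdistrib inner_diff_right inner_commute[of _ w])
  finally have drift: "hamiltonian Q (y + (1/2) *\<^sub>R d) - hamiltonian Q x
      = - (norm (dissipation_map J R Rh Q x))\<^sup>2"
    by (simp add: dissipation_map_def w_def y_def K_def)
  \<comment> \<open>The mixed term of the impulse is the drift part of \<open>u\<close> times the
    output; its own energy is quadratic in \<open>u\<close>, which explains the factor 1/2 in
    \<open>ph_output\<close>.\<close>
  have "hamiltonian Q (ph_step J R Q B x u) - hamiltonian Q (y + (1/2) *\<^sub>R d)
      = supplied_energy J R Q B x u"
    using a hamiltonian_add[OF Q(1), of "y + (1/2) *\<^sub>R d" "u *\<^sub>R B"]
    by (simp add: ph_step_def supplied_energy_def ph_output_def P_def K_def hamiltonian_scaleR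
        hamiltonian_def[of Q B] power2_eq_square algebra_simps)
  with drift show ?thesis by simp
qed

lemma scaled_square_in_class_K_infinity:
  assumes "a > 0"
  shows "(\<lambda>r. a * r\<^sup>2) \<in> class_K_infinity"
proof -
  have "\<not> bounded ((\<lambda>r. a * r\<^sup>2) ` {0..})"
  proof
    assume "bounded ((\<lambda>r. a * r\<^sup>2) ` {0..})"
    then obtain b where b: "\<And>r. r \<ge> 0 \<Longrightarrow> \<bar>a * r\<^sup>2\<bar> \<le> b"
      by (auto simp: bounded_iff)
    have "b \<ge> 0"
      using b[of 0] by simp
    \<comment> \<open>At this point the function takes the value \<open>b + 1\<close>, above the
      supposed bound.\<close>
    with b[of "sqrt ((b + 1) / a)"] assms show False
      by simp
  qed
  moreover have "strict_mono_on {0..} (\<lambda>r. a * r\<^sup>2)"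
    using assms by (auto simp: strict_mono_on_def intro!: power_strict_mono)
  ultimately show ?thesis
    using assms by (auto simp: class_K_infinity_def intro!: continuous_intros)
qed

theorem theorem9:
  fixes J R Rh :: "real^'n \<Rightarrow> real^'n^'n"
    and Q :: "real^'n^'n"
    and B x0 xN :: "real^'n"
    and X V M :: "(real^'n) set"
    and U :: "real set"
    and N :: nat
    and F :: "real^'n \<Rightarrow> real^'n"
  assumes J_skew: "\<And>x. J x = - transpose (J x)"
    and R_sym: "\<And>x. R x = transpose (R x)"
    and R_psd: "\<And>x. positive_semidefinite (R x)"
    and Q_sym: "Q = transpose Q"
    and Q_pd: "positive_definite Q"
    and R_factor: "\<And>x. transpose (Rh x) ** Rh x = R x"
    and N: "N \<ge> 1"
    and x0: "x0 \<in> X"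
    and xN: "xN \<in> X"
    and F: "F = dissipation_map J R Rh Q"
    and M: "M = {x. F x = 0}"
    and F_C2: "C2_map F"
    and M_nonempty: "M \<noteq> {}"
    and constant_rank: "\<exists>G s. open G \<and> M \<subseteq> G \<and> 0 < s \<and> s < CARD('n) \<and>
          (\<forall>x\<in>G. dim {v. frechet_derivative F (at x) v = 0} = s)"
    and V_open: "open V"
    and M_sub_V: "M \<subseteq> V"
    and V_sub_unpp: "V \<subseteq> interior (unpp M)"
    and F_lower_bound: "\<exists>c>0. \<forall>x\<in>V. c * infdist x M \<le> norm (F x)"
    and optimal_in_V: "\<And>u k.
          optimal_control (ph_step J R Q B) (supplied_energy J R Q B) X U N x0 xN u \<Longrightarrow>
          k \<le> N \<Longrightarrow> trajectory (ph_step J R Q B) x0 u k \<in> V"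
  shows "strictly_dissipative_wrt (ph_step J R Q B) (supplied_energy J R Q B) X U N x0 xN
           M (hamiltonian Q)"
proof -
  have J': "transpose (J x) = - J x" for x
    using J_skew[of x] by (metis minus_minus)
  obtain c where "c > 0" and c: "\<And>x. x \<in> V \<Longrightarrow> c * infdist x M \<le> norm (F x)"
    using F_lower_bound by blast
  show ?thesis
    unfolding strictly_dissipative_wrt_def
  proof (intro bexI allI impI)
    show "(\<lambda>r. c\<^sup>2 * r\<^sup>2) \<in> class_K_infinity"
      using \<open>c > 0\<close> by (intro scaled_square_in_class_K_infinity) simp
  next
    fix u k
    assume opt: "optimal_control (ph_step J R Q B) (supplied_energy J R Q B) X U N x0 xN u"
      and "k < N"
    let ?x = "trajectory (ph_step J R Q B) x0 u k"
    have "?x \<in> V"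
      using optimal_in_V[OF opt] \<open>k < N\<close> by simp
    \<comment> \<open>Squaring matches the linear distance bound to the quadratic energy loss; it
      preserves the order because \<open>c * infdist ?x M\<close> is nonnegative.\<close>
    then have "(c * infdist ?x M)\<^sup>2 \<le> (norm (F ?x))\<^sup>2"
      using c \<open>c > 0\<close> by (intro power_mono) (auto simp: infdist_nonneg)
    then show "hamiltonian Q (trajectory (ph_step J R Q B) x0 u (Suc k)) - hamiltonian Q ?x
        \<le> supplied_energy J R Q B ?x (u k) - c\<^sup>2 * (infdist ?x M)\<^sup>2"
      using ph_energy_balance[where J = J and R = R and Rh = Rh and x = ?x, OF J' R_factor Q_sym[symmetric] Q_pd,
          where B = B and u = "u k"]
      by (simp add: F power_mult_distrib)
  qed
qed

end
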